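(* Let $A\subset\mathbb{R}^d$ be a nonempty roughly shift-invariant set, and let $D>0$ be its density. Then $A$ is uniformly spread, and there exist a constant $C<\infty$ and a bijection $\Theta$ from $A$ onto $D^{-1/d}\mathbb{Z}^d$ such that $$\sup_{a\in A}|a-\Theta(a)|<C.$$
   Context: A set $A\subset\mathbb{R}^d$ is called discrete if its intersection with any ball is finite. A discrete set $A\subset\mathbb{R}^d$ is called roughly shift-invariant if there exists $L<\infty$ such that for every $x\in\mathbb{R}^d$ there is a bijection $\sigma_x:A\to A$ with $\sup_{a\in A}|a+x-\sigma_x(a)|<L$ (the constant $L$ does not depend on $x$; the notion does not depend on the choice of norm on $\mathbb{R}^d$). The density of a nonempty roughly shift-invariant set $A$ is the number $D>0$ such that $\lim_{T\to\infty}\#(A\cap B(x,T))/m_d(B(x,T))=D$ uniformly in $x\in\mathbb{R}^d$; every nonempty roughly shift-invariant set has such a density. Here $\#E$ is the number of points of a finite set $E$, $m_d$ is $d$-dimensional Lebesgue measure, and $B(x,T)$ is the open ball of radius $T$ centered at $x$. A discrete set $A\subset\mathbb{R}^d$ is called uniformly spread if for some $\alpha>0$ there exist a constant $C<\infty$ and a bijection $\sigma$ from $A$ onto $\alpha^{-1/d}\mathbb{Z}^d$ such that $\sup_{a\in A}|\sigma(a)-a|<C$. *)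

theory Defs
  imports "HOL-Analysis.Analysis"
begin

text \<open>
  Stronger than the library's \<open>discrete\<close>, which only asks that every point be isolated
  and so allows accumulation points outside the set.
\<close>

definition discrete_set :: "(real ^ 'n) set \<Rightarrow> bool" where
  "discrete_set A \<longleftrightarrow> (\<forall>x r. finite (A \<inter> ball x r))"

text \<open>
  Suprema of distances are taken in \<^typ>\<open>ereal\<close>, so that an unbounded family has supremum
  \<open>\<infinity>\<close> rather than an unspecified real value.
\<close>

definition roughly_shift_invariant :: "(real ^ 'n) set \<Rightarrow> bool" where
  "roughly_shift_invariant A \<longleftrightarrow> discrete_set A \<and>
     (\<exists>L::real. \<forall>x. \<exists>\<sigma>. bij_betw \<sigma> A A \<and>
        (SUP a\<in>A. ereal (norm (a + x - \<sigma> a))) < ereal L)"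

definition has_density :: "(real ^ 'n) set \<Rightarrow> real \<Rightarrow> bool" where
  "has_density A D \<longleftrightarrow> D > 0 \<and>
     uniform_limit UNIV
       (\<lambda>T x. real (card (A \<inter> ball x T)) / measure lebesgue (ball x T)) (\<lambda>x. D) at_top"

definition density_of :: "(real ^ 'n) set \<Rightarrow> real" where
  "density_of A = (THE D. has_density A D)"

lemma has_density_unique:
  assumes "has_density A D" "has_density A E"
  shows "D = E"
proof -
  let ?f = "\<lambda>T. real (card (A \<inter> ball 0 T)) / measure lebesgue (ball (0 :: real ^ 'a) T)"
  have "(?f \<longlongrightarrow> D) at_top" "(?f \<longlongrightarrow> E) at_top"
    using assms tendsto_uniform_limitI[where x = 0] unfolding has_density_def by fastforce+
  then show ?thesis
    by (rule tendsto_unique[OF trivial_limit_at_top_linorder])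
qed

lemma density_of_eq: "has_density A D \<Longrightarrow> density_of A = D"
  unfolding density_of_def using has_density_unique by blast

text \<open>Scaled so that the lattice has \<open>\<alpha>\<close> points per unit volume.\<close>

definition scaled_lattice :: "real \<Rightarrow> (real ^ 'n) set" where
  "scaled_lattice \<alpha> =
     (\<lambda>z. (\<alpha> powr (- 1 / real CARD('n))) *\<^sub>R z) ` {z. \<forall>i. z $ i \<in> \<int>}"

definition uniformly_spread :: "(real ^ 'n) set \<Rightarrow> bool" where
  "uniformly_spread A \<longleftrightarrow> discrete_set A \<and>
     (\<exists>\<alpha>>0. \<exists>C::real. \<exists>\<sigma>. bij_betw \<sigma> A (scaled_lattice \<alpha>) \<and>
        (SUP a\<in>A. ereal (norm (\<sigma> a - a))) < ereal C)"

end

theory Submission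
  imports Defs
begin

text \<open>
  Write \<open>U + r\<close> for the set of points at distance less than \<open>r\<close> from \<open>U\<close>. The proof
  compares both \<open>A\<close> and the lattice with a multiple of Lebesgue measure: a set \<open>A\<close> is
  \<open>volume_comparable D r\<close> if every finite \<open>F \<subseteq> A\<close> has at most \<open>D * vol (F + r)\<close> points and
  every bounded open \<open>W\<close> satisfies \<open>D * vol W \<le> #(A \<inter> (W + r))\<close>. If \<open>A\<close> and \<open>B\<close> both have
  this property for the same \<open>D\<close>, chaining the two inequalities gives
  \<open>#F \<le> D * vol (F + r) \<le> #(B \<inter> ((F + r) + s))\<close>, which is Hall's condition for matching each
  point of \<open>A\<close> with a point of \<open>B\<close> at distance less than \<open>r + s\<close>. The situation being symmetric,
  there are injections in both directions, and the Cantor--Bernstein construction merges them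
  into a bijection of bounded displacement.

  Hence it remains to verify the property. For the lattice it is a statement about packing and
  covering by the cubes with a corner at the lattice points. For a roughly shift-invariant \<open>A\<close>
  with constant \<open>r\<close>, the maps \<open>\<sigma>\<^sub>x\<close> give, for every translate,
  \<open>#F \<le> #(A \<inter> (F + r + x))\<close> and \<open>#(A \<inter> (W + x)) \<le> #(A \<inter> (W + r))\<close>. These are averaged over \<open>x\<close>
  by double counting (\<open>translate_double_counting\<close>): integrating \<open>#(A \<inter> (U + x))\<close> over
  \<open>x \<in> W\<close> gives the same number as integrating \<open>#(A \<inter> (W + x))\<close> over \<open>x \<in> U\<close>. Taking a large
  ball for one of the two sets brings in the ratio of the number of points of \<open>A\<close> in the
  ball to its volume. The infimum of such ratios is the required \<open>D\<close>, so that the density is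
  constructed and not presupposed. Applied to balls, the two inequalities then show that \<open>D\<close> is the
  density of \<open>A\<close>.
\<close>

section \<open>Matchings in locally finite relations\<close>

definition hall_condition :: "'a set \<Rightarrow> ('a \<times> 'b) set \<Rightarrow> bool" where
  "hall_condition X E \<longleftrightarrow> (\<forall>I\<subseteq>X. finite I \<longrightarrow> card I \<le> card (E `` I))"

text \<open>
  Rado's argument. If removing \<open>(x, y)\<close> destroys Hall's condition, there is a finite set \<open>I\<close>
  avoiding \<open>x\<close> such that the edges at \<open>I\<close> and the remaining edges at \<open>x\<close> together reach at
  most \<open>card I\<close> points. Two such sets \<open>I\<close> and \<open>J\<close>, for distinct \<open>y\<close> and \<open>z\<close>, contradict
  Hall's condition for \<open>I \<union> J \<union> {x}\<close> and \<open>I \<inter> J\<close> by submodularity of the size of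
  neighbourhoods.
\<close>
lemma hall_condition_minimal_functional:
  assumes fin: "\<And>x. x \<in> X \<Longrightarrow> finite (E `` {x})"
    and hall: "hall_condition X E"
    and minimal: "\<And>e. e \<in> E \<Longrightarrow> \<not> hall_condition X (E - {e})"
    and x: "x \<in> X"
  shows "\<exists>y. E `` {x} = {y}"
proof -
  have finI: "finite (E' `` I)" if "I \<subseteq> X" "finite I" "E' \<subseteq> E" for I E'
  proof -
    have "E' `` I \<subseteq> (\<Union>i\<in>I. E `` {i})" using that by blast
    moreover have "finite (\<Union>i\<in>I. E `` {i})" using that fin by blast
    ultimately show ?thesis using finite_subset by blast
  qed
  have violated: "\<exists>I\<subseteq>X - {x}. finite I \<and> card (E `` I \<union> (E `` {x} - {y})) \<le> card I"
    if "(x, y) \<in> E" for y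
  proof -
    have "\<not> hall_condition X (E - {(x, y)})" using minimal that by blast
    then obtain I where I: "I \<subseteq> X" "finite I" "card ((E - {(x, y)}) `` I) < card I"
      by (auto simp: hall_condition_def not_le)
    have "x \<in> I"
    proof (rule ccontr)
      assume "x \<notin> I"
      then have "(E - {(x, y)}) `` I = E `` I" by blast
      then show False using I hall by (auto simp: hall_condition_def not_le)
    qed
    have "E `` (I - {x}) \<union> (E `` {x} - {y}) \<subseteq> (E - {(x, y)}) `` I"
      using \<open>x \<in> I\<close> by blast
    then have "card (E `` (I - {x}) \<union> (E `` {x} - {y})) \<le> card ((E - {(x, y)}) `` I)"
      using finI[OF I(1,2), of "E - {(x, y)}"] by (intro card_mono) auto
    also have "\<dots> \<le> card (I - {x})" using I \<open>x \<in> I\<close> by simp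
    finally show ?thesis using I by (intro exI[of _ "I - {x}"]) auto
  qed
  have "card {x} \<le> card (E `` {x})"
    using hall x unfolding hall_condition_def by (metis empty_subsetI finite.emptyI finite_insert insert_subset)
  then obtain y where y: "(x, y) \<in> E" by (cases "E `` {x} = {}") auto
  have "z = y" if z: "(x, z) \<in> E" for z
  proof (rule ccontr)
    assume "z \<noteq> y"
    obtain I where I: "I \<subseteq> X - {x}" "finite I" "card (E `` I \<union> (E `` {x} - {y})) \<le> card I"
      using violated[OF y] by blast
    obtain J where J: "J \<subseteq> X - {x}" "finite J" "card (E `` J \<union> (E `` {x} - {z})) \<le> card J"
      using violated[OF z] by blast
    define P where "P = E `` I \<union> (E `` {x} - {y})"
    define Q where "Q = E `` J \<union> (E `` {x} - {z})"
    have fPQ: "finite P" "finite Q"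
      unfolding P_def Q_def using finI[of I E] finI[of J E] I J fin[OF x] by auto
    have "card (insert x (I \<union> J)) \<le> card (E `` insert x (I \<union> J))"
      using hall I J x unfolding hall_condition_def by (meson Diff_subset finite_UnI finite_insert insert_subset subset_trans Un_least)
    moreover have "E `` insert x (I \<union> J) = P \<union> Q"
      using \<open>z \<noteq> y\<close> unfolding P_def Q_def by blast
    moreover have "card (insert x (I \<union> J)) = Suc (card (I \<union> J))"
      using I J by (intro card_insert_disjoint) auto
    ultimately have union: "Suc (card (I \<union> J)) \<le> card (P \<union> Q)" by simp
    have "card (I \<inter> J) \<le> card (E `` (I \<inter> J))"
      using hall I J unfolding hall_condition_def by (meson Diff_subset finite_Int inf_le1 subset_trans)
    also have "\<dots> \<le> card (P \<inter> Q)"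
      using fPQ by (intro card_mono) (auto simp: P_def Q_def)
    finally have inter: "card (I \<inter> J) \<le> card (P \<inter> Q)" .
    have "card P + card Q = card (P \<union> Q) + card (P \<inter> Q)"
      "card I + card J = card (I \<union> J) + card (I \<inter> J)"
      using fPQ I J by (auto intro: card_Un_Int)
    then show False using union inter I(3) J(3) unfolding P_def Q_def by linarith
  qed
  then show ?thesis using y by blast
qed

text \<open>
  A relation that satisfies Hall's condition and is minimal with this property is the graph of
  an injection. Minimal relations exist by Zorn's lemma, applied to the sets \<open>R\<close> of removable
  edges: Hall's condition for a finite set \<open>I\<close> involves only the finitely many edges at \<open>I\<close>, and
  what a chain removes from a finite set is already removed by one of its members.
\<close>
theorem hall_locally_finite:
  assumes fin: "\<And>x. x \<in> X \<Longrightarrow> finite (E `` {x})"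
    and hall: "hall_condition X E"
  obtains f where "inj_on f X" "\<And>x. x \<in> X \<Longrightarrow> (x, f x) \<in> E"
proof -
  define \<R> where "\<R> = {R. hall_condition X (E - R)}"
  have "\<exists>M\<in>\<R>. \<forall>R\<in>\<R>. M \<subseteq> R \<longrightarrow> R = M"
  proof (rule subset_Zorn_nonempty)
    show "\<R> \<noteq> {}" using hall unfolding \<R>_def by (auto intro!: exI[of _ "{}"])
  next
    fix \<C> assume "\<C> \<noteq> {}" and chain: "subset.chain \<R> \<C>"
    have "card I \<le> card ((E - \<Union>\<C>) `` I)" if I: "I \<subseteq> X" "finite I" for I
    proof -
      have "finite (\<Union>i\<in>I. {i} \<times> E `` {i})" using I fin by blast
      then have "finite (\<Union>\<C> \<inter> (\<Union>i\<in>I. {i} \<times> E `` {i}))" by blast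
      then obtain R where R: "R \<in> \<C>" "\<Union>\<C> \<inter> (\<Union>i\<in>I. {i} \<times> E `` {i}) \<subseteq> R"
        using finite_subset_Union_chain[OF _ Int_lower1 \<open>\<C> \<noteq> {}\<close> chain] by blast
      then have "(E - \<Union>\<C>) `` I = (E - R) `` I" by blast
      moreover have "hall_condition X (E - R)"
        using R(1) chain unfolding subset.chain_def \<R>_def by blast
      ultimately show ?thesis using I unfolding hall_condition_def by metis
    qed
    then show "\<Union>\<C> \<in> \<R>" unfolding \<R>_def hall_condition_def by blast
  qed
  then obtain M where M: "hall_condition X (E - M)"
    and maxM: "\<And>R. hall_condition X (E - R) \<Longrightarrow> M \<subseteq> R \<Longrightarrow> R = M"
    unfolding \<R>_def by auto
  have "\<exists>y. (E - M) `` {x} = {y}" if "x \<in> X" for x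
  proof (rule hall_condition_minimal_functional[OF _ M _ that])
    show "finite ((E - M) `` {x})" if "x \<in> X" for x
      using fin[OF that] by (rule finite_subset[rotated]) blast
    show "\<not> hall_condition X (E - M - {e})" if "e \<in> E - M" for e
      using maxM[of "insert e M"] that by (auto simp: Diff_insert2[symmetric] Diff_insert[symmetric])
  qed
  then obtain f where f: "\<And>x. x \<in> X \<Longrightarrow> (E - M) `` {x} = {f x}" by metis
  have "inj_on f X"
  proof (rule inj_onI, rule ccontr)
    fix x y assume xy: "x \<in> X" "y \<in> X" "f x = f y" "x \<noteq> y"
    have "(E - M) `` {x, y} = (E - M) `` {x} \<union> (E - M) `` {y}" by blast
    then have "(E - M) `` {x, y} = {f y}" using f xy by simp
    moreover have "card {x, y} \<le> card ((E - M) `` {x, y})"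
      using M xy unfolding hall_condition_def by (metis empty_subsetI finite.emptyI finite_insert insert_subset)
    ultimately show False using xy by simp
  qed
  moreover have "(x, f x) \<in> E" if "x \<in> X" for x using f[OF that] by blast
  ultimately show ?thesis using that by blast
qed

text \<open>
  The bijection built from \<open>f\<close> and \<open>g\<close> sends each \<open>a\<close> either to \<open>f a\<close> or to the preimage of \<open>a\<close>
  under \<open>g\<close>, so that it inherits any relation between argument and value that both
  injections respect. The cardinality form of the theorem loses this information.
\<close>
theorem cantor_bernstein_within_relation:
  assumes f: "inj_on f A" "\<And>a. a \<in> A \<Longrightarrow> f a \<in> B \<and> P a (f a)"
    and g: "inj_on g B" "\<And>b. b \<in> B \<Longrightarrow> g b \<in> A \<and> P (g b) b"
  obtains h where "bij_betw h A B" "\<And>a. a \<in> A \<Longrightarrow> P a (h a)"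
proof -
  \<comment> \<open>The least set containing \<open>A - g ` B\<close> and closed under \<open>g \<circ> f\<close>.\<close>
  define X where "X = lfp (\<lambda>X. A - g ` (B - f ` X))"
  have X: "X = A - g ` (B - f ` X)"
    unfolding X_def by (rule lfp_unfold, rule monoI) blast
  define h where "h a = (if a \<in> X then f a else inv_into B g a)" for a
  have XA: "X \<subseteq> A" using X by blast
  have out: "\<exists>b\<in>B - f ` X. a = g b \<and> h a = b" if "a \<in> A - X" for a
  proof -
    have "a \<in> g ` (B - f ` X)" using that X by blast
    then obtain b where b: "b \<in> B - f ` X" "a = g b" by blast
    then show ?thesis using that g(1) by (auto simp: h_def)
  qed
  have "bij_betw h A B"
  proof (rule bij_betwI')
    fix x y assume xy: "x \<in> A" "y \<in> A"
    show "(h x = h y) = (x = y)"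
    proof (cases "x \<in> X"; cases "y \<in> X")
      assume "x \<in> X" "y \<in> X"
      then show ?thesis using f(1) XA by (auto simp: h_def inj_on_def)
    next
      assume "x \<in> X" "y \<notin> X"
      moreover from this have "h y \<notin> f ` X" using out[of y] xy by auto
      ultimately show ?thesis by (metis h_def imageI)
    next
      assume "x \<notin> X" "y \<in> X"
      moreover from this have "h x \<notin> f ` X" using out[of x] xy by auto
      ultimately show ?thesis by (metis h_def imageI)
    next
      assume "x \<notin> X" "y \<notin> X"
      then show ?thesis using out[of x] out[of y] xy by auto
    qed
  next
    fix x assume "x \<in> A"
    then show "h x \<in> B" using out[of x] f(2) by (cases "x \<in> X") (auto simp: h_def)
  next
    fix b assume b: "b \<in> B"
    show "\<exists>a\<in>A. b = h a"
    proof (cases "b \<in> f ` X")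
      case True
      then show ?thesis using XA by (auto simp: h_def)
    next
      case False
      then have "g b \<in> A - X" using b g(2) X by blast
      then show ?thesis using out[of "g b"] b g(1) by (auto simp: inj_on_def intro!: bexI[of _ "g b"])
    qed
  qed
  moreover have "P a (h a)" if "a \<in> A" for a
  proof (cases "a \<in> X")
    case True then show ?thesis using f(2) that by (simp add: h_def)
  next
    case False
  then have "a \<in> A - X" using that by blast
  then obtain b where "b \<in> B" "a = g b" "h a = b" using out[of a] by auto
  then show ?thesis using g(2)[of b] by simp
  qed
  ultimately show ?thesis using that by blast
qed

section \<open>Counting points against volume\<close>

definition thickening :: "(real ^ 'n) set \<Rightarrow> real \<Rightarrow> (real ^ 'n) set" where
  "thickening U r = (\<Union>u\<in>U. ball u r)"

lemma in_thickening: "y \<in> thickening U r \<longleftrightarrow> (\<exists>u\<in>U. dist u y < r)"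
  by (auto simp: thickening_def)

lemma open_thickening: "open (thickening U r)"
  unfolding thickening_def by blast

lemma bounded_thickening:
  assumes "bounded U"
  shows "bounded (thickening U r)"
proof -
  obtain c e where ce: "U \<subseteq> ball c e"
    using assms bounded_subset_ballD by blast
  have "thickening U r \<subseteq> ball c (e + r)"
  proof
    fix y assume "y \<in> thickening U r"
    then obtain u where "dist c u < e" "dist u y < r"
      using ce by (auto simp: in_thickening subset_iff)
    then show "y \<in> ball c (e + r)" using dist_triangle[of c y u] by simp
  qed
  then show ?thesis using bounded_ball bounded_subset by blast
qed

lemma finite_discrete_Int_bounded:
  assumes "discrete_set A" "bounded U"
  shows "finite (A \<inter> U)"
proof -
  obtain c e where "U \<subseteq> ball c e" using assms(2) bounded_subset_ballD by blast
  then have "A \<inter> U \<subseteq> A \<inter> ball c e" by blast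
  then show ?thesis using assms(1) finite_subset unfolding discrete_set_def by blast
qed

definition volume_comparable :: "real \<Rightarrow> real \<Rightarrow> (real ^ 'n) set \<Rightarrow> bool" where
  "volume_comparable D r A \<longleftrightarrow> discrete_set A \<and>
     (\<forall>F\<subseteq>A. finite F \<longrightarrow> card F \<le> D * measure lebesgue (thickening F r)) \<and>
     (\<forall>W. open W \<longrightarrow> bounded W \<longrightarrow> D * measure lebesgue W \<le> card (A \<inter> thickening W r))"

text \<open>
  Hall's condition for \<open>F\<close> is reached by comparing both sides with the volume of the
  neighbourhood of \<open>F\<close>.
\<close>
lemma volume_comparable_imp_injection:
  fixes A B :: "(real ^ 'n) set"
  assumes A: "volume_comparable D r A" and B: "volume_comparable D s B"
  obtains f where "inj_on f A" "\<And>a. a \<in> A \<Longrightarrow> f a \<in> B \<and> dist a (f a) < r + s"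
proof -
  define E where "E = {(a, b). a \<in> A \<and> b \<in> B \<and> dist a b < r + s}"
  have discB: "discrete_set B" using B by (simp add: volume_comparable_def)
  have "E `` {a} \<subseteq> B \<inter> ball a (r + s)" for a by (auto simp: E_def)
  then have fin: "finite (E `` {a})" for a
    using discB finite_subset unfolding discrete_set_def by metis
  have "card F \<le> card (E `` F)" if F: "F \<subseteq> A" "finite F" for F
  proof -
    let ?U = "thickening F r"
    have "real (card F) \<le> D * measure lebesgue ?U"
      using A F by (simp add: volume_comparable_def)
    also have "\<dots> \<le> card (B \<inter> thickening ?U s)"
      using B F(2) open_thickening bounded_thickening finite_imp_bounded
      unfolding volume_comparable_def by metis
    also have "B \<inter> thickening ?U s \<subseteq> E `` F"
    proof
      fix b assume "b \<in> B \<inter> thickening ?U s"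
      then obtain u a where "b \<in> B" "a \<in> F" "dist a u < r" "dist u b < s"
        by (auto simp: in_thickening)
      then show "b \<in> E `` F"
        using F dist_triangle_less_add[of a u r b s] by (auto simp: E_def dist_commute)
    qed
    then have "card (B \<inter> thickening ?U s) \<le> card (E `` F)"
    proof (rule card_mono[rotated])
      have "E `` F = (\<Union>a\<in>F. E `` {a})" by blast
      then show "finite (E `` F)" using fin F(2) by auto
    qed
    finally show ?thesis by simp
  qed
  then have "hall_condition A E" unfolding hall_condition_def by blast
  then obtain f where "inj_on f A" "\<And>a. a \<in> A \<Longrightarrow> (a, f a) \<in> E"
    using hall_locally_finite fin by metis
  then show ?thesis using that by (auto simp: E_def)
qed

lemma volume_comparable_imp_bijection:
  fixes A B :: "(real ^ 'n) set"
  assumes A: "volume_comparable D r A" and B: "volume_comparable D s B"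
  obtains h where "bij_betw h A B" "\<And>a. a \<in> A \<Longrightarrow> dist a (h a) < r + s"
proof -
  obtain f where f: "inj_on f A" "\<And>a. a \<in> A \<Longrightarrow> f a \<in> B \<and> dist a (f a) < r + s"
    using volume_comparable_imp_injection[OF A B] by blast
  obtain g where g: "inj_on g B" "\<And>b. b \<in> B \<Longrightarrow> g b \<in> A \<and> dist b (g b) < s + r"
    using volume_comparable_imp_injection[OF B A] by blast
  show ?thesis
    using cantor_bernstein_within_relation[of f A B "\<lambda>a b. dist a b < r + s" g] f g that
    by (metis add.commute dist_commute)
qed

section \<open>Double counting over translates\<close>


lemma lborel_distr_reflect:
  fixes a :: "'a::euclidean_space"
  shows "distr lborel borel (\<lambda>x. a - x) = lborel"
  using lborel_affine[of "-1" a] by (simp add: density_1)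

lemma nn_integral_reflect:
  fixes a :: "'a::euclidean_space"
  assumes [measurable]: "f \<in> borel_measurable borel"
  shows "(\<integral>\<^sup>+ x. f (a - x) \<partial>lborel) = (\<integral>\<^sup>+ x. f x \<partial>lborel)"
proof -
  have "(\<integral>\<^sup>+ x. f x \<partial>lborel) = (\<integral>\<^sup>+ x. f x \<partial>distr lborel borel (\<lambda>x. a - x))"
    by (simp add: lborel_distr_reflect)
  also have "\<dots> = (\<integral>\<^sup>+ x. f (a - x) \<partial>lborel)"
    by (rule nn_integral_distr) auto
  finally show ?thesis by simp
qed

text \<open>
  Both sides are compared with the integral of \<open>#{a \<in> A. a - x \<in> U}\<close> over \<open>x \<in> W\<close>. It is the
  sum over \<open>a\<close> of the volume of \<open>W \<inter> (a - U)\<close>, and the reflection \<open>x \<mapsto> a - x\<close> turns this set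
  into \<open>U \<inter> (a - W)\<close>: the integral is symmetric in \<open>U\<close> and \<open>W\<close>.
\<close>
lemma translate_double_counting:
  fixes A U W :: "(real ^ 'n) set" and p q :: nat
  assumes A: "discrete_set A"
    and U: "open U" "bounded U" and W: "open W" "bounded W"
    and p: "\<And>x. x \<in> W \<Longrightarrow> p \<le> card {a \<in> A. a - x \<in> U}"
    and q: "\<And>x. x \<in> U \<Longrightarrow> card {a \<in> A. a - x \<in> W} \<le> q"
  shows "p * measure lebesgue W \<le> q * measure lebesgue U"
proof -
  have [measurable]: "U \<in> sets borel" "W \<in> sets borel" using U W by auto
  \<comment> \<open>Only these finitely many points contribute, so that sum and integral commute.\<close>
  define A0 where "A0 = A \<inter> (\<Union>x\<in>U. \<Union>y\<in>W. {x + y})"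
  have fin: "finite A0"
    unfolding A0_def by (rule finite_discrete_Int_bounded[OF A bounded_sums[OF U(2) W(2)]])
  have A0: "a \<in> A0" if "a \<in> A" "u \<in> U" "w \<in> W" "u + w = a" for a u w
    using that unfolding A0_def by blast
  have "of_nat p * emeasure lborel W = (\<integral>\<^sup>+ x. of_nat p * indicator W x \<partial>lborel)"
    by (subst nn_integral_cmult_indicator) auto
  also have "\<dots> \<le> (\<integral>\<^sup>+ x. (\<Sum>a\<in>A0. indicator U (a - x) * indicator W x) \<partial>lborel)"
  proof (rule nn_integral_mono)
    fix x
    show "of_nat p * indicator W x \<le> (\<Sum>a\<in>A0. indicator U (a - x) * indicator W x :: ennreal)"
    proof (cases "x \<in> W")
      case True
      then have "{a \<in> A. a - x \<in> U} = {a \<in> A0. a - x \<in> U}"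
        using A0[of _ "_ - x" x] by (auto simp: A0_def)
      then have "p \<le> card {a \<in> A0. a - x \<in> U}" using p[OF True] by simp
      also have "of_nat \<dots> = (\<Sum>a\<in>A0. indicator U (a - x) :: ennreal)"
        using fin by (simp add: indicator_def sum.If_cases Int_def)
      finally show ?thesis using True by simp
    qed simp
  qed
  also have "\<dots> = (\<Sum>a\<in>A0. \<integral>\<^sup>+ x. indicator U (a - x) * indicator W x \<partial>lborel)"
    by (rule nn_integral_sum) measurable
  also have "\<dots> = (\<Sum>a\<in>A0. \<integral>\<^sup>+ x. indicator U x * indicator W (a - x) \<partial>lborel)"
  proof (rule sum.cong[OF refl])
    fix a
    have "(\<integral>\<^sup>+ x. indicator U (a - x) * indicator W (a - (a - x)) \<partial>lborel) =
      (\<integral>\<^sup>+ x. indicator U x * indicator W (a - x) \<partial>lborel)"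
      by (rule nn_integral_reflect) measurable
    then show "(\<integral>\<^sup>+ x. indicator U (a - x) * indicator W x \<partial>lborel) =
      (\<integral>\<^sup>+ x. indicator U x * indicator W (a - x) \<partial>lborel)" by simp
  qed
  also have "\<dots> = (\<integral>\<^sup>+ x. (\<Sum>a\<in>A0. indicator U x * indicator W (a - x)) \<partial>lborel)"
    by (rule nn_integral_sum[symmetric]) measurable
  also have "\<dots> \<le> (\<integral>\<^sup>+ x. of_nat q * indicator U x \<partial>lborel)"
  proof (rule nn_integral_mono)
    fix x
    show "(\<Sum>a\<in>A0. indicator U x * indicator W (a - x)) \<le> (of_nat q * indicator U x :: ennreal)"
    proof (cases "x \<in> U")
      case True
      then have "{a \<in> A. a - x \<in> W} = {a \<in> A0. a - x \<in> W}"
        using A0[of _ x "_ - x"] by (auto simp: A0_def)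
      then have le_q: "card {a \<in> A0. a - x \<in> W} \<le> q" using q[OF True] by simp
      have "(\<Sum>a\<in>A0. indicator W (a - x) :: ennreal) = of_nat (card {a \<in> A0. a - x \<in> W})"
        using fin by (simp add: indicator_def sum.If_cases Int_def)
      also have "\<dots> \<le> of_nat q" using le_q by simp
      finally show ?thesis using True by simp
    qed simp
  qed
  also have "\<dots> = of_nat q * emeasure lborel U"
    by (subst nn_integral_cmult_indicator) auto
  finally have "of_nat p * emeasure lborel W \<le> of_nat q * emeasure lborel U" .
  moreover have "emeasure lborel V = ennreal (measure lebesgue V)" if "open V" "bounded V" for V :: "(real ^ 'n) set"
    using that emeasure_bounded_finite[of V] by (simp add: emeasure_eq_ennreal_measure top.not_eq_extremum)
  ultimately have "ennreal (p * measure lebesgue W) \<le> ennreal (q * measure lebesgue U)"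
    using U W by (simp add: ennreal_mult ennreal_of_nat_eq_real_of_nat)
  then show ?thesis by (simp add: ennreal_le_iff)
qed

text \<open>
  Rough shift-invariance with the constant made explicit and the suprema replaced by
  pointwise bounds.
\<close>
definition shiftable_within :: "real \<Rightarrow> (real ^ 'n) set \<Rightarrow> bool" where
  "shiftable_within r A \<longleftrightarrow> discrete_set A \<and>
     (\<forall>x. \<exists>\<sigma>. bij_betw \<sigma> A A \<and> (\<forall>a\<in>A. dist (a + x) (\<sigma> a) < r))"

lemma roughly_shift_invariant_imp_shiftable:
  assumes "roughly_shift_invariant A" "A \<noteq> {}"
  obtains r where "r > 0" "shiftable_within r A"
proof -
  obtain L :: real where disc: "discrete_set A" and L:
    "\<And>x. \<exists>\<sigma>. bij_betw \<sigma> A A \<and> (SUP a\<in>A. ereal (norm (a + x - \<sigma> a))) < ereal L"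
    using assms(1) unfolding roughly_shift_invariant_def by blast
  have *: "dist (a + x) (\<sigma> a) < L"
    if "(SUP a\<in>A. ereal (norm (a + x - \<sigma> a))) < ereal L" "a \<in> A" for x \<sigma> a
  proof -
    have "ereal (norm (a + x - \<sigma> a)) \<le> (SUP a\<in>A. ereal (norm (a + x - \<sigma> a)))"
      using that(2) by (rule SUP_upper)
    also note that(1)
    finally show ?thesis by (simp add: dist_norm)
  qed
  have sh: "shiftable_within L A"
    unfolding shiftable_within_def using disc L * by meson
  obtain a where "a \<in> A" using assms by blast
  then obtain \<sigma> where "dist (a + 0) (\<sigma> a) < L"
    using sh unfolding shiftable_within_def by blast
  then have "L > 0" using zero_le_dist le_less_trans by blast
  then show ?thesis using sh that by blast
qed

lemma card_le_card_translate:
  assumes A: "shiftable_within r A" and F: "F \<subseteq> A" "bounded U" "thickening F r \<subseteq> U"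
  shows "card F \<le> card {a \<in> A. a - x \<in> U}"
proof -
  obtain \<sigma> where \<sigma>: "bij_betw \<sigma> A A" "\<And>a. a \<in> A \<Longrightarrow> dist (a + x) (\<sigma> a) < r"
    using A unfolding shiftable_within_def by blast
  have "\<sigma> ` F \<subseteq> {a \<in> A. a - x \<in> U}"
  proof
    fix b assume "b \<in> \<sigma> ` F"
    then obtain a where a: "a \<in> F" "b = \<sigma> a" by blast
    then have "b \<in> A" using \<sigma>(1) F(1) by (auto simp: bij_betw_def)
    moreover have "dist a (b - x) < r"
      using \<sigma>(2)[of a] a F(1) by (auto simp: dist_norm algebra_simps)
    then have "b - x \<in> thickening F r" using a(1) by (auto simp: in_thickening)
    then have "b - x \<in> U" using F(3) by blast
    ultimately show "b \<in> {a \<in> A. a - x \<in> U}" by simp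
  qed
  moreover have "finite {a \<in> A. a - x \<in> U}"
  proof -
    have "{a \<in> A. a - x \<in> U} = A \<inter> (+) x ` U" by (force simp: image_iff)
    then show ?thesis
      using finite_discrete_Int_bounded[of A] bounded_translation[OF F(2), of x] A
      by (simp add: shiftable_within_def)
  qed
  moreover have "inj_on \<sigma> F" using \<sigma>(1) F(1) by (auto simp: bij_betw_def intro: inj_on_subset)
  ultimately show ?thesis using card_inj_on_le by blast
qed

text \<open>
  The shift by \<open>-x\<close> moves the points of \<open>A\<close> in the translate of \<open>W\<close> back close to \<open>W\<close>.
\<close>
lemma card_translate_le_card:
  assumes A: "shiftable_within r A" and W: "bounded U" "thickening W r \<subseteq> U"
  shows "card {a \<in> A. a - x \<in> W} \<le> card (A \<inter> U)"
proof -
  obtain \<sigma> where \<sigma>: "bij_betw \<sigma> A A" "\<And>a. a \<in> A \<Longrightarrow> dist (a + (-x)) (\<sigma> a) < r"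
    using A unfolding shiftable_within_def by blast
  have "\<sigma> ` {a \<in> A. a - x \<in> W} \<subseteq> A \<inter> U"
  proof
    fix b assume "b \<in> \<sigma> ` {a \<in> A. a - x \<in> W}"
    then obtain a where a: "a \<in> A" "a - x \<in> W" "b = \<sigma> a" by blast
    then have "b \<in> A" using \<sigma>(1) by (auto simp: bij_betw_def)
    moreover have "b \<in> U" using \<sigma>(2)[of a] a W(2) by (auto simp: in_thickening subset_iff)
    ultimately show "b \<in> A \<inter> U" by simp
  qed
  moreover have "finite (A \<inter> U)"
    using A W(1) finite_discrete_Int_bounded by (auto simp: shiftable_within_def)
  moreover have "inj_on \<sigma> {a \<in> A. a - x \<in> W}"
    using \<sigma>(1) by (auto simp: bij_betw_def intro: inj_on_subset)
  ultimately show ?thesis using card_inj_on_le by blast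
qed

lemma thickening_ball_subset: "thickening (ball x s) r \<subseteq> ball x (s + r)"
proof
  fix y assume "y \<in> thickening (ball x s) r"
  then obtain u where "dist x u < s" "dist u y < r" by (auto simp: in_thickening)
  then show "y \<in> ball x (s + r)" using dist_triangle[of x y u] by simp
qed

lemma thickening_mono: "U \<subseteq> V \<Longrightarrow> thickening U r \<subseteq> thickening V r"
  by (auto simp: thickening_def)

lemma measure_lebesgue_ball:
  assumes "0 \<le> r"
  shows "measure lebesgue (ball (x :: real ^ 'n) r) = unit_ball_vol CARD('n) * r ^ CARD('n)"
  using content_ball[OF assms, of x] by simp

lemma ratio_power_tendsto_1:
  fixes c :: real
  shows "((\<lambda>T. ((T + c) / T) ^ n) \<longlongrightarrow> 1) at_top"
proof -
  have "((\<lambda>T. 1 + c / T) \<longlongrightarrow> 1 + 0) at_top"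
    by (intro tendsto_intros real_tendsto_divide_at_top[OF tendsto_const] filterlim_ident)
  moreover have "\<forall>\<^sub>F T in at_top. 1 + c / T = (T + c) / T"
    using eventually_gt_at_top[of 0] by eventually_elim (simp add: field_simps)
  ultimately have "((\<lambda>T. (T + c) / T) \<longlongrightarrow> 1) at_top"
    using tendsto_cong by fastforce
  from tendsto_power[OF this, of n] show ?thesis by simp
qed

lemma measure_ball_ratio:
  fixes x y :: "real ^ 'n"
  assumes "0 < T" "0 \<le> T + c"
  shows "measure lebesgue (ball y (T + c)) / measure lebesgue (ball x T) = ((T + c) / T) ^ CARD('n)"
proof -
  have "unit_ball_vol (real CARD('n)) \<noteq> 0" 
    using unit_ball_vol_pos[of "CARD('n)"] by (metis less_irrefl of_nat_0_le_iff)
  then show ?thesis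
    using assms measure_lebesgue_ball[of T x] measure_lebesgue_ball[of "T + c" y]
    by (simp add: power_divide)
qed


section \<open>Density of shift-invariant sets\<close>

text \<open>
  With \<open>n\<close> and \<open>v\<close> for the number of points and the volume of the centred ball, double counting
  against balls yields the estimates \<open>upper\<close> and \<open>lower\<close> below. The first bounds
  \<open>#F / vol (F + r)\<close> by every ratio \<open>n (S + r) / v S\<close>, hence by their infimum \<open>D\<close>. In the second
  \<open>n T\<close> is at least \<open>D * v (T - r)\<close>, which leaves the factor \<open>v (T - r) / v (T + r)\<close>; it tends
  to \<open>1\<close>.
\<close>
lemma shiftable_imp_volume_comparable:
  fixes A :: "(real ^ 'n) set"
  assumes A: "shiftable_within r A" and "A \<noteq> {}" and "r > 0"
  obtains D where "D > 0" "volume_comparable D r A"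
proof -
  have disc: "discrete_set A" using A by (simp add: shiftable_within_def)
  define v where "v T = measure lebesgue (ball (0 :: real ^ 'n) T)" for T
  define n where "n T = card (A \<inter> ball 0 T)" for T
  define D where "D = (INF S\<in>{0<..}. n (S + r) / v S)"
  have v_pos: "v T > 0" if "T > 0" for T using that by (simp add: v_def)
  have upper: "card F * v S \<le> n (S + r) * measure lebesgue (thickening F r)"
    if "F \<subseteq> A" "finite F" "S > 0" for F S
    unfolding v_def n_def
  proof (rule translate_double_counting[OF disc])
    show "open (thickening F r)" "bounded (thickening F r)"
      using that by (auto simp: open_thickening bounded_thickening finite_imp_bounded)
    then show "card F \<le> card {a \<in> A. a - x \<in> thickening F r}" for x
      using card_le_card_translate[OF A that(1)] by blast
    show "card {a \<in> A. a - x \<in> ball 0 S} \<le> card (A \<inter> ball 0 (S + r))" for x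
      by (rule card_translate_le_card[OF A bounded_ball thickening_ball_subset])
  qed auto
  have lower: "n T * measure lebesgue W \<le> card (A \<inter> thickening W r) * v (T + r)"
    if "open W" "bounded W" for W T
    unfolding v_def n_def
  proof (rule translate_double_counting[OF disc])
    have "thickening (A \<inter> ball 0 T) r \<subseteq> ball 0 (T + r)"
      using thickening_mono[OF Int_lower2] thickening_ball_subset by blast
    then show "card (A \<inter> ball 0 T) \<le> card {a \<in> A. a - x \<in> ball 0 (T + r)}" for x
      by (rule card_le_card_translate[OF A Int_lower1 bounded_ball])
    show "card {a \<in> A. a - x \<in> W} \<le> card (A \<inter> thickening W r)" for x
      by (rule card_translate_le_card[OF A bounded_thickening[OF that(2)] order_refl])
  qed (use that in auto)
  have bdd: "bdd_below ((\<lambda>S. n (S + r) / v S) ` {0<..})"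
    using v_pos by (intro bdd_belowI2[of _ 0]) (simp add: less_imp_le)
  have D_nonneg: "D \<ge> 0"
    unfolding D_def using v_pos by (intro cINF_greatest) (auto simp: less_imp_le)
  have D_upper: "card F \<le> D * measure lebesgue (thickening F r)" if F: "F \<subseteq> A" "finite F" for F
  proof (cases "F = {}")
    case True then show ?thesis using D_nonneg by simp
  next
    case False
    let ?m = "measure lebesgue (thickening F r)"
    have "0 < card F * v 1" using False F v_pos[of 1] by (simp add: card_gt_0_iff)
    then have "?m \<noteq> 0" using upper[OF F, of 1] by (intro notI) simp
    then have m: "?m > 0" by (simp add: zero_less_measure_iff)
    have "card F / ?m \<le> D"
      unfolding D_def
    proof (rule cINF_greatest)
      fix S :: real assume "S \<in> {0<..}"
      then show "card F / ?m \<le> n (S + r) / v S"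
        using upper[OF F, of S] m v_pos[of S] by (simp add: field_simps)
    qed auto
    then show ?thesis using m by (simp add: field_simps)
  qed
  have D_lower: "D * measure lebesgue W \<le> card (A \<inter> thickening W r)"
    if W: "open W" "bounded W" for W
  proof -
    let ?m = "measure lebesgue W"
    \<comment> \<open>\<open>T\<close> is the radius of the larger ball here; the points are counted at radius \<open>T - r\<close>.\<close>
    have "\<forall>\<^sub>F T in at_top. D * ?m * ((T + - 2 * r) / T) ^ CARD('n) \<le> card (A \<inter> thickening W r)"
      using eventually_gt_at_top[of "2 * r"]
    proof eventually_elim
      case (elim T)
      have pos: "T > 0" "T - 2 * r > 0" using elim \<open>r > 0\<close> by auto
      have "D \<le> n (T - 2 * r + r) / v (T - 2 * r)"
        unfolding D_def by (rule cINF_lower[OF bdd]) (use pos in simp)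
      then have "D * v (T - 2 * r) \<le> n (T - r)"
        using v_pos[OF pos(2)] by (simp add: field_simps)
      then have "D * v (T - 2 * r) * ?m \<le> n (T - r) * ?m" by (intro mult_right_mono) auto
      also have "\<dots> \<le> card (A \<inter> thickening W r) * v T" using lower[OF W, of "T - r"] by simp
      finally have "D * ?m * (v (T - 2 * r) / v T) \<le> card (A \<inter> thickening W r)"
        using v_pos[OF pos(1)] by (simp add: field_simps)
      moreover have "v (T - 2 * r) / v T = ((T + - 2 * r) / T) ^ CARD('n)"
        using measure_ball_ratio[of T "- 2 * r" "0 :: real ^ 'n" 0] pos by (simp add: v_def)
      ultimately show ?case by simp
    qed
    moreover have "((\<lambda>T. D * ?m * ((T + - 2 * r) / T) ^ CARD('n)) \<longlongrightarrow> D * ?m * 1) at_top"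
      by (intro tendsto_intros ratio_power_tendsto_1)
    ultimately show ?thesis
      using tendsto_upperbound trivial_limit_at_top_linorder by fastforce
  qed
  obtain a where "a \<in> A" using assms by blast
  then have "D \<noteq> 0" using D_upper[of "{a}"] by auto
  then show ?thesis
    using that[of D] D_nonneg D_upper D_lower disc by (simp add: volume_comparable_def)
qed

text \<open>
  The number of points in a ball of radius \<open>T\<close> lies between \<open>D\<close> times the volumes of the balls
  of radius \<open>T - r\<close> and \<open>T + r\<close>. These bounds do not depend on the centre, hence uniformity.
\<close>
lemma volume_comparable_imp_has_density:
  fixes A :: "(real ^ 'n) set"
  assumes A: "volume_comparable D r A" and "D > 0" "r > 0"
  shows "has_density A D"
  unfolding has_density_def uniform_limit_iff
proof (intro conjI allI impI)
  show "D > 0" by fact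
  fix e :: real assume "e > 0"
  have disc: "discrete_set A" using A by (simp add: volume_comparable_def)
  have "\<forall>\<^sub>F T in at_top. dist (D * ((T + c) / T) ^ CARD('n)) D < e" for c
  proof -
    have "((\<lambda>T. D * ((T + c) / T) ^ CARD('n)) \<longlongrightarrow> D * 1) at_top"
      by (intro tendsto_intros ratio_power_tendsto_1)
    then show ?thesis using tendstoD[OF _ \<open>e > 0\<close>] by simp
  qed
  from this[of r] this[of "- r"] eventually_gt_at_top[of r]
  show "\<forall>\<^sub>F T in at_top. \<forall>x\<in>UNIV.
      dist (real (card (A \<inter> ball x T)) / measure lebesgue (ball x T)) D < e"
  proof eventually_elim
    case (elim T)
    show ?case
    proof
      fix x :: "real ^ 'n"
      let ?v = "\<lambda>T. measure lebesgue (ball x T)"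
      have T: "T > 0" "T + - r \<ge> 0" "T + r \<ge> 0" using elim \<open>r > 0\<close> by auto
      have v: "?v T > 0" using T by simp
      have fin: "finite (A \<inter> ball x T)"
        using finite_discrete_Int_bounded[OF disc bounded_ball] .
      have "real (card (A \<inter> ball x T)) \<le> D * measure lebesgue (thickening (A \<inter> ball x T) r)"
        using A fin by (simp add: volume_comparable_def)
      also have "\<dots> \<le> D * ?v (T + r)"
      proof (intro mult_left_mono measure_mono_fmeasurable)
        show "thickening (A \<inter> ball x T) r \<subseteq> ball x (T + r)"
          using thickening_mono[OF Int_lower2] thickening_ball_subset by blast
        show "thickening (A \<inter> ball x T) r \<in> sets lebesgue"
          by (rule fmeasurableD, rule lmeasurable_open[OF bounded_thickening open_thickening])
            (rule bounded_Int, simp)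
      qed (use \<open>D > 0\<close> in auto)
      finally have "card (A \<inter> ball x T) / ?v T \<le> D * (?v (T + r) / ?v T)"
        using v by (simp add: field_simps)
      then have ub: "card (A \<inter> ball x T) / ?v T \<le> D * ((T + r) / T) ^ CARD('n)"
        by (simp only: measure_ball_ratio[OF T(1) T(3)])
      have "D * ?v (T + - r) \<le> card (A \<inter> thickening (ball x (T + - r)) r)"
        using A by (simp add: volume_comparable_def)
      also have "\<dots> \<le> card (A \<inter> ball x T)"
        using thickening_ball_subset[of x "T + - r" r] by (intro of_nat_mono card_mono fin) auto
      finally have "D * (?v (T + - r) / ?v T) \<le> card (A \<inter> ball x T) / ?v T"
        using v by (simp add: field_simps)
      then have lb: "D * ((T + - r) / T) ^ CARD('n) \<le> card (A \<inter> ball x T) / ?v T"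
        by (simp only: measure_ball_ratio[OF T(1) T(2)])
      show "dist (card (A \<inter> ball x T) / ?v T) D < e"
        using elim(1,2) ub lb unfolding dist_real_def by linarith
    qed
  qed
qed

section \<open>The scaled lattice\<close>

definition cell :: "real \<Rightarrow> real ^ 'n \<Rightarrow> (real ^ 'n) set" where
  "cell s a = cbox a (\<chi> i. a $ i + s)"

definition open_cell :: "real \<Rightarrow> real ^ 'n \<Rightarrow> (real ^ 'n) set" where
  "open_cell s a = box a (\<chi> i. a $ i + s)"

lemma measure_cell:
  assumes "s \<ge> 0"
  shows "measure lebesgue (cell s (a :: real ^ 'n)) = s ^ CARD('n)"
proof -
  have "a \<in> cell s a" using assms by (simp add: cell_def mem_box_cart)
  then have "cell s a \<noteq> {}" by blast
  then show ?thesis by (simp add: cell_def content_cbox_cart)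
qed

lemma measure_open_cell:
  assumes "s \<ge> 0"
  shows "measure lebesgue (open_cell s (a :: real ^ 'n)) = s ^ CARD('n)"
  using measure_cell[OF assms, of a]
  by (simp add: cell_def open_cell_def measure_lborel_box_eq measure_lborel_cbox_eq)

lemma cell_subset_ball: "cell s (a :: real ^ 'n) \<subseteq> ball a (s * CARD('n) + 1)"
proof
  fix y assume y: "y \<in> cell s a"
  have "dist a y \<le> (\<Sum>i\<in>UNIV. \<bar>(a - y) $ i\<bar>)" unfolding dist_norm by (rule norm_le_l1_cart)
  also have "\<dots> \<le> (\<Sum>i\<in>(UNIV :: 'n set). s)"
  proof (rule sum_mono)
    fix i
    have "a $ i \<le> y $ i" "y $ i \<le> a $ i + s" using y by (auto simp: cell_def mem_box_cart)
    then show "\<bar>(a - y) $ i\<bar> \<le> s" by simp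
  qed
  finally show "y \<in> ball a (s * CARD('n) + 1)" by (simp add: mult.commute)
qed

text \<open>
  The open cells at lattice points are disjoint, which bounds the number of lattice points
  from above by volume; the closed cells cover the space, which bounds it from below.
\<close>
lemma lattice_volume_comparable:
  fixes \<Lambda> :: "(real ^ 'n) set" and s :: real
  assumes "s > 0" and \<Lambda>: "\<Lambda> = {y. \<forall>i. \<exists>k::int. y $ i = s * k}"
  shows "volume_comparable (1 / s ^ CARD('n)) (s * CARD('n) + 1) \<Lambda>"
proof -
  define R where "R = s * CARD('n) + 1"
  have cell_ball: "cell s a \<subseteq> ball a R" for a :: "real ^ 'n"
    using cell_subset_ball by (simp add: R_def)
  have open_cell_ball: "open_cell s a \<subseteq> ball a R" for a :: "real ^ 'n"
    using cell_ball[of a] box_subset_cbox unfolding cell_def open_cell_def by blast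
  have disjoint: "open_cell s a \<inter> open_cell s b = {}" if ab: "a \<in> \<Lambda>" "b \<in> \<Lambda>" "a \<noteq> b" for a b
  proof (rule equals0I)
    fix y assume y: "y \<in> open_cell s a \<inter> open_cell s b"
    obtain i where i: "a $ i \<noteq> b $ i" using ab(3) by (auto simp: vec_eq_iff)
    obtain k l :: int where kl: "a $ i = s * k" "b $ i = s * l" using ab \<Lambda> by blast
    have "a $ i < y $ i" "y $ i < a $ i + s" "b $ i < y $ i" "y $ i < b $ i + s"
      using y by (auto simp: open_cell_def mem_box_cart)
    then have "s * k < s * (l + 1)" "s * l < s * (k + 1)" using kl by (auto simp: algebra_simps)
    then have "real_of_int k < real_of_int l + 1" "real_of_int l < real_of_int k + 1"
      using \<open>s > 0\<close> by (auto simp: mult_less_cancel_left_pos)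
    then have "k = l" by linarith
    then show False using i kl by simp
  qed
  have packing: "card G \<le> 1 / s ^ CARD('n) * measure lebesgue V"
    if G: "finite G" "G \<subseteq> \<Lambda>" and V: "thickening G R \<subseteq> V" "V \<in> lmeasurable" for G V
  proof -
    have "card G * s ^ CARD('n) = (\<Sum>a\<in>G. measure lebesgue (open_cell s a))"
      using \<open>s > 0\<close> by (simp add: measure_open_cell)
    also have "\<dots> = measure lebesgue (\<Union>a\<in>G. open_cell s a)"
      using G disjoint
      by (intro measure_UNION'[symmetric]) (auto simp: open_cell_def pairwise_def disjnt_def)
    also have "\<dots> \<le> measure lebesgue V"
    proof (intro measure_mono_fmeasurable V(2))
      show "(\<Union>a\<in>G. open_cell s a) \<subseteq> V"
        using open_cell_ball V(1) unfolding thickening_def by blast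
      show "(\<Union>a\<in>G. open_cell s a) \<in> sets lebesgue"
        using G(1) by (intro sets.finite_UN) (auto simp: open_cell_def)
    qed
    finally show ?thesis using \<open>s > 0\<close> by (simp add: field_simps)
  qed
  \<comment> \<open>The packing bound also limits the size of all finite sets of lattice points in a ball.\<close>
  have disc: "discrete_set \<Lambda>"
    unfolding discrete_set_def
  proof (intro allI)
    fix x :: "real ^ 'n" and t :: real
    let ?m = "1 / s ^ CARD('n) * measure lebesgue (ball x (t + R))"
    show "finite (\<Lambda> \<inter> ball x t)"
    proof (rule finite_if_finite_subsets_card_bdd[of _ "nat \<lfloor>?m\<rfloor>", THEN conjunct1])
      fix G assume G: "G \<subseteq> \<Lambda> \<inter> ball x t" "finite G"
      have "thickening G R \<subseteq> ball x (t + R)"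
        using thickening_mono[of G "ball x t"] G(1) thickening_ball_subset by blast
      then have "real (card G) \<le> ?m" using packing[of G "ball x (t + R)"] G by auto
      then show "card G \<le> nat \<lfloor>?m\<rfloor>" by linarith
    qed
  qed
  have covering: "1 / s ^ CARD('n) * measure lebesgue W \<le> card (\<Lambda> \<inter> thickening W R)"
    if W: "open W" "bounded W" for W
  proof -
    let ?G = "\<Lambda> \<inter> thickening W R"
    have fin: "finite ?G"
      using finite_discrete_Int_bounded[OF disc bounded_thickening[OF W(2)]] .
    have cover: "W \<subseteq> (\<Union>a\<in>?G. cell s a)"
    proof
      fix w assume w: "w \<in> W"
      \<comment> \<open>Rounding down each coordinate finds the cell that contains \<open>w\<close>.\<close>
      define a :: "real ^ 'n" where "a = (\<chi> i. s * \<lfloor>w $ i / s\<rfloor>)"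
      have "w \<in> cell s a"
        unfolding cell_def mem_box_cart
      proof (intro allI conjI)
        fix i
        have "\<lfloor>w $ i / s\<rfloor> \<le> w $ i / s" "w $ i / s \<le> \<lfloor>w $ i / s\<rfloor> + 1" by linarith+
        then have "s * \<lfloor>w $ i / s\<rfloor> \<le> s * (w $ i / s)" "s * (w $ i / s) \<le> s * (\<lfloor>w $ i / s\<rfloor> + 1)"
          using \<open>s > 0\<close> by (auto simp only: mult_le_cancel_left_pos)
        then show "a $ i \<le> w $ i" "w $ i \<le> (\<chi> i. a $ i + s) $ i"
          using \<open>s > 0\<close> by (simp_all add: a_def algebra_simps)
      qed
      moreover have "a \<in> \<Lambda>" by (auto simp: \<Lambda> a_def)
      moreover have "a \<in> thickening W R"
      proof -
        have "dist a w < R" using cell_ball[of a] \<open>w \<in> cell s a\<close> by auto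
        then show ?thesis using w by (auto simp: in_thickening dist_commute)
      qed
      ultimately show "w \<in> (\<Union>a\<in>?G. cell s a)" by blast
    qed
    have "measure lebesgue W \<le> measure lebesgue (\<Union>a\<in>?G. cell s a)"
    proof (rule measure_mono_fmeasurable[OF cover])
      show "W \<in> sets lebesgue" using lmeasurable_open[OF W(2,1)] by (rule fmeasurableD)
      show "(\<Union>a\<in>?G. cell s a) \<in> lmeasurable"
        using fin by (intro fmeasurable.finite_UN) (auto simp: cell_def)
    qed
    also have "\<dots> \<le> (\<Sum>a\<in>?G. measure lebesgue (cell s a))"
      using fin by (intro measure_UNION_le) (auto simp: cell_def)
    also have "\<dots> = card ?G * s ^ CARD('n)" using \<open>s > 0\<close> by (simp add: measure_cell)
    finally show ?thesis using \<open>s > 0\<close> by (simp add: field_simps)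
  qed
  have "card F \<le> 1 / s ^ CARD('n) * measure lebesgue (thickening F R)"
    if "F \<subseteq> \<Lambda>" "finite F" for F
    using that
    by (intro packing lmeasurable_open open_thickening bounded_thickening finite_imp_bounded) auto
  then show ?thesis using disc covering unfolding volume_comparable_def R_def by blast
qed

text \<open>
  The cells of the scaled lattice have volume \<open>1 / D\<close>.
\<close>
lemma scaled_lattice_volume_comparable:
  assumes "D > 0"
  obtains R where "volume_comparable D R (scaled_lattice D :: (real ^ 'n) set)"
proof -
  define s where "s = D powr (- 1 / CARD('n))"
  have "s > 0" using assms by (simp add: s_def)
  have "s ^ CARD('n) = D powr (- 1)"
    using assms by (simp add: s_def powr_realpow[symmetric] powr_powr)
  then have D: "1 / s ^ CARD('n) = D" using assms by (simp add: powr_minus inverse_eq_divide)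
  have "(scaled_lattice D :: (real ^ 'n) set) = {y. \<forall>i. \<exists>k::int. y $ i = s * k}"
  proof (intro equalityI subsetI)
    fix y :: "real ^ 'n" assume "y \<in> scaled_lattice D"
    then obtain z where "y = s *\<^sub>R z" "\<forall>i. z $ i \<in> \<int>"
      unfolding scaled_lattice_def s_def by blast
    then show "y \<in> {y. \<forall>i. \<exists>k::int. y $ i = s * k}" by (auto elim: Ints_cases)
  next
    fix y :: "real ^ 'n" assume y: "y \<in> {y. \<forall>i. \<exists>k::int. y $ i = s * k}"
    have "\<forall>i. ((1 / s) *\<^sub>R y) $ i \<in> \<int>"
    proof
      fix i
      obtain k :: int where "y $ i = s * k" using y by blast
      then show "((1 / s) *\<^sub>R y) $ i \<in> \<int>" using \<open>s > 0\<close> by simp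
    qed
    moreover have "y = s *\<^sub>R ((1 / s) *\<^sub>R y)" using \<open>s > 0\<close> by simp
    ultimately show "y \<in> scaled_lattice D"
      unfolding scaled_lattice_def s_def[symmetric] by blast
  qed
  from lattice_volume_comparable[OF \<open>s > 0\<close> this] show ?thesis using that D by metis
qed

section \<open>Uniform spreading\<close>

theorem theorem2:
  fixes A :: "(real ^ 'n) set"
  assumes "roughly_shift_invariant A" and "A \<noteq> {}"
  shows "uniformly_spread A \<and>
    (\<exists>C::real. \<exists>\<Theta>. bij_betw \<Theta> A (scaled_lattice (density_of A)) \<and>
       (SUP a\<in>A. ereal (norm (a - \<Theta> a))) < ereal C)"
proof -
  obtain r where r: "r > 0" "shiftable_within r A"
    using roughly_shift_invariant_imp_shiftable[OF assms] .
  obtain D where D: "D > 0" "volume_comparable D r A"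
    using shiftable_imp_volume_comparable[OF r(2) assms(2) r(1)] .
  have density: "density_of A = D"
    using volume_comparable_imp_has_density[OF D(2,1) r(1)] by (rule density_of_eq)
  obtain R where "volume_comparable D R (scaled_lattice D :: (real ^ 'n) set)"
    using scaled_lattice_volume_comparable[OF D(1)] .
  then obtain \<Theta> where \<Theta>: "bij_betw \<Theta> A (scaled_lattice D)"
    "\<And>a. a \<in> A \<Longrightarrow> dist a (\<Theta> a) < r + R"
    using volume_comparable_imp_bijection[OF D(2)] by blast
  have "(SUP a\<in>A. ereal (norm (a - \<Theta> a))) \<le> ereal (r + R)"
    using \<Theta>(2) by (intro SUP_least) (simp add: dist_norm less_imp_le)
  also have "\<dots> < ereal (r + R + 1)" by simp
  finally have SUP: "(SUP a\<in>A. ereal (norm (a - \<Theta> a))) < ereal (r + R + 1)" .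
  have "discrete_set A" using assms(1) by (simp add: roughly_shift_invariant_def)
  moreover have "(SUP a\<in>A. ereal (norm (\<Theta> a - a))) < ereal (r + R + 1)"
    using SUP by (simp add: norm_minus_commute)
  ultimately have "uniformly_spread A"
    unfolding uniformly_spread_def using D(1) \<Theta>(1) by blast
  then show ?thesis unfolding density using \<Theta>(1) SUP by blast
qed

end
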